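(* Let $S$ be a compact oriented surface, possibly with boundary, let $T$ be a finite semi-simplicial triangulation of $S$, let $\Delta: E(T) \to (0,\pi]$ be a function on the edges of $T$, and let $H_d: \pi_1(S \setminus V(T)) \to \mathbb{R}$ be a representation. Then there exists a (singular) similarity structure on $S$ with dilatational holonomy $H_d$ and cone points contained in $V(T)$, whose Delaunay triangulation is combinatorially equivalent to $T$ and has dihedral angles given by $\Delta$, if and only if the following two conditions hold: (1) $\Delta(e) > 0$ for all $e \in E(T)$; (2) for every set of faces $\mathcal{F} \subseteq F(T)$, writing $E(\mathcal{F})$ for the set of edges incident to some face in $\mathcal{F}$, $$\sum_{e \in E(\mathcal{F})} \Delta(e) \ge \pi |\mathcal{F}|,$$ with equality if and only if $\mathcal{F} = F(T)$ or $E(\mathcal{F}) = \emptyset$.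
   Context: A semi-simplicial triangulation is one in which distinct closed cells may intersect in a collection of lower-dimensional cells; $V(T),E(T),F(T)$ are its vertices, edges, faces. A similarity structure on $S$ with singularities in $V(T)$ is an atlas on $S \setminus V(T)$ whose transition maps are Euclidean similarities; equivalently, $S$ is assembled from Euclidean triangles glued along edges by similarities in the pattern of $T$ (if all gluings are isometries it is a singular Euclidean structure). Its holonomy is a representation of $\pi_1(S\setminus V(T))$ into the similarity group; the dilatational holonomy $H_d$ is $\gamma \mapsto \log$ of the dilatation factor of the holonomy of $\gamma$. For a geodesic triangulation with Euclidean triangular faces: if $e=AB$ is a boundary edge lying in face $ABC$, its dihedral angle is the angle of $ABC$ at $C$; if $e=AB$ is an interior edge lying in faces $ABC$ and $ABD$, its dihedral angle is the sum of the angle of $ABC$ at $C$ and the angle of $ABD$ at $D$. A triangulation is Delaunay if the dihedral angle of every interior edge is at most $\pi$. *)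

theory Defs
  imports Complex_Main
begin

(* Combinatorial model of a finite semi-simplicial triangulation of a compact
   oriented connected surface: a finite set F of oriented triangular faces,
   each with sides (f,0),(f,1),(f,2) (side i is opposite corner i), and a
   partial fixed-point-free involution gl on sides describing which sides are
   glued (orientation-compatibly).  Unglued sides are boundary sides. *)

type_synonym 'f side = "'f \<times> nat"

definition sides :: "'f set \<Rightarrow> 'f side set" where
  "sides F = F \<times> {0,1,2}"

definition dual_adj :: "('f side \<Rightarrow> 'f side option) \<Rightarrow> 'f \<Rightarrow> 'f \<Rightarrow> bool" where
  "dual_adj gl f g \<longleftrightarrow> (\<exists>i<3. \<exists>t. gl (f,i) = Some t \<and> fst t = g)"

definition triangulation :: "'f set \<Rightarrow> ('f side \<Rightarrow> 'f side option) \<Rightarrow> bool" where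
  "triangulation F gl \<longleftrightarrow> finite F \<and> F \<noteq> {} \<and>
     (\<forall>s. gl s \<noteq> None \<longrightarrow> s \<in> sides F) \<and>
     (\<forall>s t. gl s = Some t \<longrightarrow> t \<in> sides F \<and> t \<noteq> s \<and> gl t = Some s) \<and>
     (\<forall>f\<in>F. \<forall>g\<in>F. (dual_adj gl)\<^sup>*\<^sup>* f g)"

definition edge_of :: "('f side \<Rightarrow> 'f side option) \<Rightarrow> 'f side \<Rightarrow> 'f side set" where
  "edge_of gl s = insert s (set_option (gl s))"

definition edges :: "'f set \<Rightarrow> ('f side \<Rightarrow> 'f side option) \<Rightarrow> 'f side set set" where
  "edges F gl = edge_of gl ` sides F"

definition edges_of_faces :: "('f side \<Rightarrow> 'f side option) \<Rightarrow> 'f set \<Rightarrow> 'f side set set" where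
  "edges_of_faces gl \<FF> = edge_of gl ` sides \<FF>"

definition interior_edge :: "'f side set \<Rightarrow> bool" where
  "interior_edge e \<longleftrightarrow> card e = 2"

definition euclidean_triangle :: "('f side \<Rightarrow> real) \<Rightarrow> 'f \<Rightarrow> bool" where
  "euclidean_triangle l f \<longleftrightarrow>
     (\<forall>i<3. 0 < l (f,i) \<and> l (f,i) < l (f, (i+1) mod 3) + l (f, (i+2) mod 3))"

definition opp_angle :: "('f side \<Rightarrow> real) \<Rightarrow> 'f side \<Rightarrow> real" where
  "opp_angle l s = (let f = fst s; i = snd s;
      a = l (f, (i+1) mod 3); b = l (f, (i+2) mod 3); c = l (f,i)
    in arccos ((a\<^sup>2 + b\<^sup>2 - c\<^sup>2) / (2*a*b)))"

definition dihedral :: "('f side \<Rightarrow> real) \<Rightarrow> 'f side set \<Rightarrow> real" where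
  "dihedral l e = (\<Sum>s\<in>e. opp_angle l s)"

definition delaunay :: "'f set \<Rightarrow> ('f side \<Rightarrow> 'f side option) \<Rightarrow> ('f side \<Rightarrow> real) \<Rightarrow> bool" where
  "delaunay F gl l \<longleftrightarrow> (\<forall>e\<in>edges F gl. interior_edge e \<longrightarrow> dihedral l e \<le> pi)"

(* closed walks in the dual graph (generate \<pi>_1(S - V(T)), which deformation
   retracts onto the dual graph): crossing side s of face fst s into the face
   of the side it is glued to *)
definition dual_loop :: "'f set \<Rightarrow> ('f side \<Rightarrow> 'f side option) \<Rightarrow> 'f side list \<Rightarrow> bool" where
  "dual_loop F gl ws \<longleftrightarrow> ws \<noteq> [] \<and>
     (\<forall>k<length ws. ws!k \<in> sides F \<and> gl (ws!k) \<noteq> None \<and>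
        fst (the (gl (ws!k))) = fst (ws ! ((k+1) mod length ws)))"

(* log of the dilatation factor of the similarity gluing across side s *)
definition log_ratio :: "('f side \<Rightarrow> 'f side option) \<Rightarrow> ('f side \<Rightarrow> real) \<Rightarrow> 'f side \<Rightarrow> real" where
  "log_ratio gl l s = ln (l (the (gl s)) / l s)"

definition dil_holonomy :: "('f side \<Rightarrow> 'f side option) \<Rightarrow> ('f side \<Rightarrow> real) \<Rightarrow> 'f side list \<Rightarrow> real" where
  "dil_holonomy gl l ws = sum_list (map (log_ratio gl l) ws)"

(* a representation \<pi>_1(S - V(T)) \<rightarrow> \<real> given by a cocycle h on oriented dual edges;
   its value on the loop ws is the sum of h along ws *)
definition dual_cocycle :: "'f set \<Rightarrow> ('f side \<Rightarrow> 'f side option) \<Rightarrow> ('f side \<Rightarrow> real) \<Rightarrow> bool" where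
  "dual_cocycle F gl h \<longleftrightarrow> (\<forall>s\<in>sides F. gl s \<noteq> None \<longrightarrow> h (the (gl s)) = - h s)"

definition rep_value :: "('f side \<Rightarrow> real) \<Rightarrow> 'f side list \<Rightarrow> real" where
  "rep_value h ws = sum_list (map h ws)"

(* existence of a similarity structure on S, cone points in V(T), with geodesic
   Delaunay triangulation combinatorially equal to T, dihedral angles \<Delta>,
   dilatational holonomy H_d (= h) *)
definition realizable :: "'f set \<Rightarrow> ('f side \<Rightarrow> 'f side option) \<Rightarrow> ('f side set \<Rightarrow> real)
    \<Rightarrow> ('f side \<Rightarrow> real) \<Rightarrow> bool" where
  "realizable F gl \<Delta> h \<longleftrightarrow> (\<exists>l.
     (\<forall>f\<in>F. euclidean_triangle l f) \<and>
     delaunay F gl l \<and>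
     (\<forall>e\<in>edges F gl. dihedral l e = \<Delta> e) \<and>
     (\<forall>ws. dual_loop F gl ws \<longrightarrow> dil_holonomy gl l ws = rep_value h ws))"

end

(* Write the side lengths as exp (x e - h s / 2) with one real unknown x e per edge e: this makes the
   gluing across a side s scale by exp (h s), so every choice of x has the prescribed dilatational
   holonomy. After extending the angles continuously to degenerate triangles, it remains to find a
   zero of the continuous map G x e = (sum of the angles opposite to e) - Delta e. Angles decay
   exponentially in the logarithmic length gaps, so the pairing of x with G x is, up to a constant,
   at least pi * (sum over the faces of the largest x on the face) - (sum over the edges of
   Delta e * x e). Decomposing x into superlevel sets U, and applying condition (2) to the faces
   that avoid U, bounds this from below by eps * (max x - min x). Brouwer's theorem on a large box then
   gives the zero. No face is degenerate there, again by condition (2), since Delta <= pi makes an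
   angle pi use up its whole edge. The converse is double counting of positive angles. *)

theory Submission
  imports Defs "HOL-Analysis.Complex_Transcendental" "HOL-Analysis.Brouwer_Fixpoint"
    "HOL-Analysis.Function_Metric"
begin

section \<open>A variational inequality on a box\<close>

lemma tendsto_fun_iff:
  fixes f :: "'c \<Rightarrow> 'a \<Rightarrow> 'b::topological_space"
  shows "(f \<longlongrightarrow> l) F \<longleftrightarrow> (\<forall>i. ((\<lambda>x. f x i) \<longlongrightarrow> l i) F)"
  using limitin_componentwise[of "\<lambda>_. euclidean" UNIV f l F]
  by (simp add: euclidean_product_topology)

text \<open>Brouwer's theorem for a box whose dimension \<open>n\<close> is not tied to a type, hence derived from the
  combinatorial lemma of Kuhn rather than from the fixed point theorem on Euclidean spaces.\<close>

lemma box_variational_inequality: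
  fixes g :: "(nat \<Rightarrow> real) \<Rightarrow> nat \<Rightarrow> real"
  assumes K: "0 < K" and cont: "\<And>i. i < n \<Longrightarrow> continuous_on UNIV (\<lambda>x. g x i)"
  obtains x where "\<And>i. \<bar>x i\<bar> \<le> K" "\<And>i. n \<le> i \<Longrightarrow> x i = 0"
    "\<And>i. i < n \<Longrightarrow> x i < K \<Longrightarrow> 0 \<le> g x i" "\<And>i. i < n \<Longrightarrow> - K < x i \<Longrightarrow> g x i \<le> 0"
proof -
  \<comment> \<open>\<open>X m r\<close> is the point with grid index \<open>r\<close> for mesh
    \<open>2 * K / Suc m\<close> in the box, padded with 0 from coordinate \<open>n\<close> on, so
    that all grids lie in one sequence space.\<close>
  define X where "X m r = (\<lambda>i. if i < n then 2 * K * real (r i) / real (Suc m) - K else 0)"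
    for m and r :: "nat \<Rightarrow> nat"
  \<comment> \<open>Kuhn's lemma requires label 0 on the lower faces of the cube and label 1 on the
    upper ones; in between, the label records the sign of \<open>g\<close>.\<close>
  define label where "label m r i =
    (if r i = 0 \<or> (r i < Suc m \<and> g (X m r) i < 0) then 0 else (1::nat))" for m r i
  define near where "near q r \<longleftrightarrow> (\<forall>j<n. q j \<le> r j \<and> r j \<le> q j + 1)" for q r :: "nat \<Rightarrow> nat"
  define separated where "separated q m i r s \<longleftrightarrow>
    near q r \<and> near q s \<and> label m r i = 0 \<and> label m s i = 1" for q m i r s
  have "\<exists>q. (\<forall>i<n. q i < Suc m) \<and> (\<forall>i<n. \<exists>r s. separated q m i r s)" for m
  proof -
    obtain q where q: "\<forall>i<n. q i < Suc m" and
      l: "\<forall>i<n. \<exists>r s. (\<forall>j<n. q j \<le> r j \<and> r j \<le> q j + 1) \<and>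
        (\<forall>j<n. q j \<le> s j \<and> s j \<le> q j + 1) \<and> label m r i \<noteq> label m s i"
      by (rule kuhn_lemma[of "Suc m" n "label m"]) (auto simp: label_def)
    have two: "label m r i = 0 \<or> label m r i = 1" for r i by (auto simp: label_def)
    have "\<exists>r s. separated q m i r s" if i: "i < n" for i
    proof -
      obtain r s where rs: "near q r" "near q s" "label m r i \<noteq> label m s i"
        using l[rule_format, OF i] unfolding near_def by blast
      then have "separated q m i r s \<or> separated q m i s r"
        using two[of r i] two[of s i] by (auto simp: separated_def)
      then show ?thesis by blast
    qed
    with q show ?thesis by blast
  qed
  then obtain q where q: "\<And>m i. i < n \<Longrightarrow> q m i < Suc m" and
    "\<And>m. \<forall>i<n. \<exists>r s. separated (q m) m i r s"
    by metis
  then have "\<forall>m i. \<exists>r s. i < n \<longrightarrow> separated (q m) m i r s"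
    by blast
  then obtain r where "\<forall>m i. \<exists>s. i < n \<longrightarrow> separated (q m) m i (r m i) s"
    by metis
  then obtain s where "\<And>m i. i < n \<Longrightarrow> separated (q m) m i (r m i) (s m i)"
    by metis
  then have r: "\<And>m i. i < n \<Longrightarrow> near (q m) (r m i)" "\<And>m i. i < n \<Longrightarrow> label m (r m i) i = 0"
    and s: "\<And>m i. i < n \<Longrightarrow> near (q m) (s m i)" "\<And>m i. i < n \<Longrightarrow> label m (s m i) i = 1"
    by (auto simp: separated_def)
  let ?C = "PiE UNIV (\<lambda>i::nat. {-K..K})"
  \<comment> \<open>Tychonoff gives compactness in the full sequence space; a countable product is
    first countable, so sequential compactness follows.\<close>
  have "compactin (product_topology (\<lambda>i::nat. euclidean) UNIV) ?C"
    by (subst compactin_PiE) (auto simp: compactin_euclidean_iff)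
  then have "seq_compact ?C"
    by (auto simp: euclidean_product_topology compactin_euclidean_iff intro: compact_imp_seq_compact)
  moreover have "X m (q m) \<in> ?C" for m
  proof -
    have "2 * K * real (q m i) / real (Suc m) \<le> 2 * K" if "i < n" for i
      using q[OF that, of m] K by (simp add: divide_le_eq)
    then show ?thesis using K by (auto simp: X_def)
  qed
  ultimately obtain y \<rho> where y: "y \<in> ?C" and \<rho>: "strict_mono \<rho>"
    and lim: "(\<lambda>m. X (\<rho> m) (q (\<rho> m))) \<longlonglongrightarrow> y"
    by (elim seq_compactE[where f = "\<lambda>m. X m (q m)"]) (auto simp: comp_def)
  have small: "(\<lambda>m. 2 * K / real (Suc (\<rho> m))) \<longlonglongrightarrow> 0"
    using LIMSEQ_subseq_LIMSEQ[OF LIMSEQ_Suc[OF lim_const_over_n[of "2 * K"]] \<rho>]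
    by (simp add: comp_def)
  \<comment> \<open>The cells shrink with the mesh, so every choice of one vertex in each of them
    has the same limit \<open>y\<close>.\<close>
  have lim_near: "(\<lambda>m. X (\<rho> m) (t m)) \<longlonglongrightarrow> y" if t: "\<And>m. near (q (\<rho> m)) (t m)" for t
  proof -
    have "(\<lambda>m. X (\<rho> m) (t m) j) \<longlonglongrightarrow> y j" for j
    proof -
      have 1: "(\<lambda>m. X (\<rho> m) (q (\<rho> m)) j) \<longlonglongrightarrow> y j"
        using lim by (simp add: tendsto_fun_iff)
      have "(\<lambda>m. X (\<rho> m) (t m) j - X (\<rho> m) (q (\<rho> m)) j) \<longlonglongrightarrow> 0"
      proof (rule Lim_null_comparison[OF always_eventually small], rule allI)
        fix m
        have "\<bar>2 * K * (real (t m j) - real (q (\<rho> m) j))\<bar> \<le> 2 * K" if "j < n"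
          using t[of m] that K unfolding near_def abs_mult
          by (fastforce simp: mult_le_cancel_left1 abs_le_iff)
        then have "\<bar>2 * K * (real (t m j) - real (q (\<rho> m) j)) / real (Suc (\<rho> m))\<bar>
            \<le> 2 * K / real (Suc (\<rho> m))" if "j < n"
          using that unfolding abs_divide by (auto intro!: divide_right_mono)
        moreover have "X (\<rho> m) (t m) j - X (\<rho> m) (q (\<rho> m)) j =
            (if j < n then 2 * K * (real (t m j) - real (q (\<rho> m) j)) / real (Suc (\<rho> m)) else 0)"
          by (simp add: X_def diff_divide_distrib right_diff_distrib)
        ultimately show "norm (X (\<rho> m) (t m) j - X (\<rho> m) (q (\<rho> m)) j) \<le> 2 * K / real (Suc (\<rho> m))"
          using K by simp
      qed
      from tendsto_add[OF 1 this] show ?thesis by simp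
    qed
    then show ?thesis by (simp add: tendsto_fun_iff)
  qed
  have g: "(\<lambda>m. g (X (\<rho> m) (t m)) i) \<longlonglongrightarrow> g y i" and c: "(\<lambda>m. X (\<rho> m) (t m) i) \<longlonglongrightarrow> y i"
    if "\<And>m. near (q (\<rho> m)) (t m)" "i < n" for t i
    using continuous_on_tendsto_compose[OF cont[OF that(2)] lim_near[OF that(1)]]
      continuous_on_tendsto_compose[OF continuous_on_product_coordinates lim_near[OF that(1)]] by auto
  show ?thesis
  proof (rule that[of y])
    show "\<bar>y i\<bar> \<le> K" for i using y by (auto simp: PiE_iff abs_le_iff minus_le_iff)
    show "y i = 0" if "n \<le> i" for i
    proof -
      have "(\<lambda>m. X (\<rho> m) (q (\<rho> m)) i) \<longlonglongrightarrow> y i"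
        using continuous_on_tendsto_compose[OF continuous_on_product_coordinates lim] by auto
      then show ?thesis using that by (simp add: X_def LIMSEQ_const_iff)
    qed
  next
    fix i assume i: "i < n"
    \<comment> \<open>The vertices of label 1 eventually stay off the upper face, so their label
      comes from \<open>0 \<le> g\<close>, which survives in the limit. Vertices of label 0 give the
      other sign in the same way.\<close>
    { assume "y i < K"
      then have "\<forall>\<^sub>F m in sequentially. X (\<rho> m) (s (\<rho> m) i) i < K"
        using order_tendstoD(2)[OF c[OF s(1)[OF i] i]] by blast
      then have "\<forall>\<^sub>F m in sequentially. 0 \<le> g (X (\<rho> m) (s (\<rho> m) i)) i"
      proof eventually_elim
        case (elim m)
        then have "s (\<rho> m) i i \<noteq> Suc (\<rho> m)" using i K by (auto simp: X_def)
        moreover have "s (\<rho> m) i i \<le> Suc (\<rho> m)"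
          using s(1)[OF i, of "\<rho> m"] q[OF i, of "\<rho> m"] i unfolding near_def by fastforce
        ultimately show ?case
          using s(2)[OF i, of "\<rho> m"] by (auto simp: label_def split: if_splits)
      qed
      then show "0 \<le> g y i"
        using tendsto_lowerbound[OF g[OF s(1)[OF i] i]] by simp }
    { assume "- K < y i"
      then have "\<forall>\<^sub>F m in sequentially. - K < X (\<rho> m) (r (\<rho> m) i) i"
        using order_tendstoD(1)[OF c[OF r(1)[OF i] i]] by blast
      then have "\<forall>\<^sub>F m in sequentially. g (X (\<rho> m) (r (\<rho> m) i)) i \<le> 0"
      proof eventually_elim
        case (elim m)
        then have "r (\<rho> m) i i \<noteq> 0" using i by (intro notI) (simp add: X_def)
        then show ?case
          using r(2)[OF i, of "\<rho> m"] by (auto simp: label_def split: if_splits)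
      qed
      then show "g y i \<le> 0"
        using tendsto_upperbound[OF g[OF r(1)[OF i] i]] by simp }
  qed
qed

section \<open>Angles of possibly degenerate triangles\<close>

definition cos_ratio :: "real \<Rightarrow> real \<Rightarrow> real \<Rightarrow> real" where
  "cos_ratio a b c = (a\<^sup>2 + b\<^sup>2 - c\<^sup>2) / (2 * a * b)"

text \<open>Clamping the cosine extends the angle opposite to the side \<open>c\<close> continuously to all positive
  side lengths: a triple violating the triangle inequality gets the angles \<open>\<pi>, 0, 0\<close>.\<close>

definition tri_angle :: "real \<Rightarrow> real \<Rightarrow> real \<Rightarrow> real" where
  "tri_angle a b c = arccos (max (- 1) (min 1 (cos_ratio a b c)))"

lemma tri_angle_commute: "tri_angle a b c = tri_angle b a c"
  by (simp add: tri_angle_def cos_ratio_def ac_simps)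

lemma tri_angle_bounds: "0 \<le> tri_angle a b c" "tri_angle a b c \<le> pi"
  unfolding tri_angle_def by (auto intro!: arccos_lbound arccos_ubound)

lemma cos_ratio_less_one:
  assumes "0 < a" "0 < b" "0 < c" "a < b + c" "b < a + c"
  shows "cos_ratio a b c < 1"
proof -
  have "0 < (c - (a - b)) * (c + (a - b))"
    using assms by (intro mult_pos_pos) auto
  then show ?thesis
    using assms by (simp add: cos_ratio_def divide_less_eq power2_eq_square algebra_simps)
qed

lemma cos_ratio_greater_minus_one:
  assumes "0 < a" "0 < b" "0 < c" "c < a + b"
  shows "- 1 < cos_ratio a b c"
proof -
  have "0 < (a + b - c) * (a + b + c)"
    using assms by (intro mult_pos_pos) auto
  then show ?thesis
    using assms by (simp add: cos_ratio_def less_divide_eq power2_eq_square algebra_simps)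
qed

lemma tri_angle_eq_pi:
  assumes "0 < a" "0 < b" "a + b \<le> c"
  shows "tri_angle a b c = pi"
proof -
  have "0 \<le> (c - (a + b)) * (c + (a + b))"
    using assms by (intro mult_nonneg_nonneg) auto
  then have "cos_ratio a b c \<le> - 1"
    using assms by (simp add: cos_ratio_def divide_le_eq power2_eq_square algebra_simps)
  then show ?thesis by (simp add: tri_angle_def)
qed

lemma tri_angle_eq_0:
  assumes "0 < a" "0 < b" "0 < c" "b + c \<le> a"
  shows "tri_angle a b c = 0"
proof -
  have "0 \<le> ((a - b) - c) * ((a - b) + c)"
    using assms by (intro mult_nonneg_nonneg) auto
  then have "1 \<le> cos_ratio a b c"
    using assms by (simp add: cos_ratio_def le_divide_eq power2_eq_square algebra_simps)
  then show ?thesis by (simp add: tri_angle_def)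
qed

lemma tri_angle_nondegenerate:
  assumes "0 < a" "0 < b" "0 < c" "a < b + c" "b < a + c" "c < a + b"
  shows "tri_angle a b c = arccos (cos_ratio a b c)" "0 < tri_angle a b c"
proof -
  have *: "cos_ratio a b c < 1" "- 1 < cos_ratio a b c"
    using assms by (auto intro!: cos_ratio_less_one cos_ratio_greater_minus_one)
  then show eq: "tri_angle a b c = arccos (cos_ratio a b c)" by (simp add: tri_angle_def)
  show "0 < tri_angle a b c"
    using arccos_lt_bounded[of "cos_ratio a b c"] * by (simp add: eq)
qed

text \<open>For a genuine triangle the right-hand radicand is 16 times the squared area, hence the
  same at all three corners. This is what simplifies the product of two sines in the angle
  sum.\<close>

lemma sqrt_one_minus_cos_ratio:
  assumes "0 < a" "0 < b"
  shows "sqrt (1 - (cos_ratio a b c)\<^sup>2) =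
    sqrt (4 * a\<^sup>2 * b\<^sup>2 - (a\<^sup>2 + b\<^sup>2 - c\<^sup>2)\<^sup>2) / (2 * a * b)"
proof -
  have "1 - (cos_ratio a b c)\<^sup>2 = (4 * a\<^sup>2 * b\<^sup>2 - (a\<^sup>2 + b\<^sup>2 - c\<^sup>2)\<^sup>2) / (2 * a * b)\<^sup>2"
    using assms unfolding cos_ratio_def power_divide
    by (simp add: divide_simps power_mult_distrib)
  then show ?thesis using assms by (simp add: real_sqrt_divide real_sqrt_abs)
qed

text \<open>Degenerate triples give the angles \<pi>, 0, 0. Otherwise the addition theorem shows
  that \<open>arccos p + arccos q\<close> and \<open>pi - arccos r\<close> have the same cosine, and
  cosine is injective on [0, \<pi>].\<close>

lemma tri_angle_sum:
  assumes "0 < a" "0 < b" "0 < c"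
  shows "tri_angle a b c + tri_angle b c a + tri_angle c a b = pi"
proof -
  consider "a + b \<le> c" | "b + c \<le> a" | "c + a \<le> b" | "a < b + c" "b < a + c" "c < a + b"
    by linarith
  then show ?thesis
  proof cases
    case 1
    then show ?thesis using assms tri_angle_eq_pi[of a b c] tri_angle_eq_0[of c a b] tri_angle_eq_0[of c b a]
      by (simp add: tri_angle_commute[of b c a] )
  next
    case 2
    then show ?thesis using assms tri_angle_eq_pi[of b c a] tri_angle_eq_0[of a b c] tri_angle_eq_0[of a c b]
      by (simp add: tri_angle_commute[of c a b] )
  next
    case 3
    then show ?thesis using assms tri_angle_eq_pi[of c a b] tri_angle_eq_0[of b c a] tri_angle_eq_0[of b a c]
      by (simp add: tri_angle_commute[of a b c] )
  next
    case 4
    define p q r where "p = cos_ratio b c a" and "q = cos_ratio c a b" and "r = cos_ratio a b c"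
    have p: "- 1 < p" "p < 1" and q: "- 1 < q" "q < 1" and r: "- 1 < r" "r < 1"
      unfolding p_def q_def r_def using assms 4
      by (auto intro!: cos_ratio_less_one cos_ratio_greater_minus_one)
    define S where "S = 4 * a\<^sup>2 * b\<^sup>2 - (a\<^sup>2 + b\<^sup>2 - c\<^sup>2)\<^sup>2"
    have S0: "S = (a+b+c) * (a+b-c) * (a+c-b) * (b+c-a)"
      and Sp: "S = 4 * b\<^sup>2 * c\<^sup>2 - (b\<^sup>2 + c\<^sup>2 - a\<^sup>2)\<^sup>2" and Sq: "S = 4 * c\<^sup>2 * a\<^sup>2 - (c\<^sup>2 + a\<^sup>2 - b\<^sup>2)\<^sup>2"
      unfolding S_def by (simp_all add: power2_eq_square algebra_simps)
    have "0 \<le> S" using assms 4 unfolding S0 by (intro mult_nonneg_nonneg) auto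
    have "cos (arccos p + arccos q) = p * q - sqrt (1 - p\<^sup>2) * sqrt (1 - q\<^sup>2)"
      using p q by (simp add: cos_add cos_arccos sin_arccos)
    also have "sqrt (1 - p\<^sup>2) * sqrt (1 - q\<^sup>2) = S / ((2 * b * c) * (2 * c * a))"
      using assms \<open>0 \<le> S\<close> by (simp add: p_def q_def sqrt_one_minus_cos_ratio flip: Sp Sq)
    also have "p * q - S / ((2 * b * c) * (2 * c * a)) = - r"
      using assms unfolding p_def q_def r_def cos_ratio_def S_def
      by (simp add: divide_simps) (simp add: power2_eq_square algebra_simps)
    also have "- r = cos (pi - arccos r)"
      using r by (simp add: cos_arccos)
    finally have eq: "cos (arccos p + arccos q) = cos (pi - arccos r)" .
    \<comment> \<open>Injectivity of cosine needs \<open>arccos p + arccos q \<le> pi\<close>, that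
      is \<open>- q \<le> p\<close>; the factorization makes the sign of \<open>p + q\<close>
      visible.\<close>
    have "p + q = (a + b) * (c\<^sup>2 - (a - b)\<^sup>2) / (2 * a * b * c)"
      using assms unfolding p_def q_def cos_ratio_def
      by (simp add: divide_simps) (simp add: power2_eq_square algebra_simps)
    also have "c\<^sup>2 - (a - b)\<^sup>2 = (c - (a - b)) * (c + (a - b))"
      by (simp add: power2_eq_square algebra_simps)
    finally have "0 \<le> p + q"
      using assms 4 by (auto intro!: mult_nonneg_nonneg divide_nonneg_pos)
    then have "arccos p \<le> arccos (- q)"
      using p q by (intro arccos_le_arccos) auto
    then have le: "arccos p + arccos q \<le> pi"
      using q by (simp add: arccos_minus)
    have "arccos p + arccos q = pi - arccos r"
    proof (rule cos_inj_pi[OF _ le _ _ eq])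
      show "0 \<le> arccos p + arccos q"
        using p q arccos_lbound[of p] arccos_lbound[of q] by simp
      show "0 \<le> pi - arccos r" "pi - arccos r \<le> pi"
        using r arccos_lbound[of r] arccos_ubound[of r] by auto
    qed
    then show ?thesis
      using assms 4 by (simp add: tri_angle_nondegenerate p_def q_def r_def)
  qed
qed

text \<open>By the law of cosines, 1 minus the cosine is at most \<open>(c / a)\<^sup>2\<close>, and
  \<open>t \<le> tan t\<close> turns this into a linear bound. The argument yields the constant 4,
  which is relaxed to \<open>2 * pi\<close>.\<close>

lemma tri_angle_le_side_ratio:
  assumes "0 < a" "0 < b" "0 < c" "2 * c \<le> a"
  shows "tri_angle a b c \<le> 2 * pi * c / a"
proof (cases "b + c \<le> a")
  case True
  then show ?thesis using assms by (simp add: tri_angle_eq_0)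
next
  case False
  then have b: "a / 2 \<le> b" using assms by linarith
  \<comment> \<open>Only the upper clamp is kept: the estimate below gives
    \<open>1 / 2 \<le> q\<close>, so the lower one is inactive.\<close>
  define q where "q = min 1 (cos_ratio a b c)"
  have "1 - cos_ratio a b c = (c\<^sup>2 - (a - b)\<^sup>2) / (2 * a * b)"
    using assms by (simp add: cos_ratio_def divide_simps) (simp add: power2_eq_square algebra_simps)
  also have "\<dots> \<le> c\<^sup>2 / (2 * a * b)"
    using assms by (intro divide_right_mono) auto
  also have "\<dots> \<le> c\<^sup>2 / (2 * a * (a / 2))"
    using assms b by (intro divide_left_mono mult_left_mono mult_pos_pos) auto
  also have "\<dots> = (c / a)\<^sup>2"
    by (simp add: power2_eq_square)
  finally have q1: "1 - q \<le> (c / a)\<^sup>2" by (auto simp: q_def min_def)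
  have "(c / a)\<^sup>2 \<le> (1 / 2)\<^sup>2"
    using assms by (intro power_mono) (auto simp: divide_simps)
  also have "(1 / 2)\<^sup>2 = (1 / 4 :: real)" by (simp add: power2_eq_square)
  finally have q: "1 / 2 \<le> q" "q \<le> 1" using q1 by (simp_all add: q_def del: min_le_iff_disj)
  define t where "t = tri_angle a b c"
  have t: "t = arccos q" using q by (simp add: t_def tri_angle_def q_def)
  have "0 \<le> t" using tri_angle_bounds t_def by simp
  have "t < pi / 2"
    using arccos_less_arccos[of 0 q] q by (simp add: t)
  then have "t \<le> tan t"
    using abs_tan_ge[of t] \<open>0 \<le> t\<close> tan_pos_pi2_le[of t] by simp
  also have "\<dots> = sqrt (1 - q\<^sup>2) / q"
    using q by (simp add: tan_def t sin_arccos)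
  also have "\<dots> \<le> sqrt (2\<^sup>2 * (c / a)\<^sup>2) / (1 / 2)"
  proof (intro frac_le real_sqrt_le_mono)
    have "1 - q\<^sup>2 = (1 - q) * (1 + q)" by (simp add: power2_eq_square algebra_simps)
    also have "\<dots> \<le> (c / a)\<^sup>2 * 2\<^sup>2" using q q1 by (intro mult_mono) auto
    finally show "1 - q\<^sup>2 \<le> 2\<^sup>2 * (c / a)\<^sup>2" by simp
  qed (use q in auto)
  also have "\<dots> = 4 * (c / a)"
    using assms unfolding real_sqrt_mult real_sqrt_abs by simp
  also have "\<dots> \<le> 2 * pi * (c / a)"
    using assms pi_gt3 by (intro mult_right_mono) auto
  finally show ?thesis by (simp add: t_def)
qed

text \<open>The decay estimate in logarithmic form: for short \<open>c\<close> the factor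
  \<open>c / a\<close> absorbs \<open>ln (a / c) \<le> a / c\<close>. For \<open>c\<close>
  comparable with \<open>a\<close> the logarithm is at most 1.\<close>

lemma tri_angle_mult_ln_le:
  assumes "0 < a" "0 < b" "0 < c" "c \<le> a"
  shows "tri_angle a b c * ln (a / c) \<le> 2 * pi"
proof (cases "2 * c \<le> a")
  case True
  have "tri_angle a b c * ln (a / c) \<le> (2 * pi * c / a) * (a / c)"
    using assms True tri_angle_le_side_ratio tri_angle_bounds ln_bound[of "a/c"]
    by (intro mult_mono) auto
  then show ?thesis using assms by simp
next
  case False
  have "ln (a / c) \<le> a / c - 1" using assms by (intro ln_le_minus_one) auto
  also have "\<dots> \<le> 1" using False assms by (simp add: divide_simps)
  finally have "ln (a / c) \<le> 1" .
  then have "tri_angle a b c * ln (a / c) \<le> pi * 1"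
    using assms tri_angle_bounds by (intro mult_mono) auto
  also have "\<dots> \<le> 2 * pi" by simp
  finally show ?thesis .
qed

section \<open>Coercivity\<close>

text \<open>A discrete layer-cake argument by induction on the number of values of \<open>x\<close>:
  truncating \<open>x\<close> at its second largest value lowers the right-hand side by at least
  \<open>\<epsilon>\<close> times the drop, by \<open>gap\<close> for the top level set. For
  constant \<open>x\<close>, \<open>total\<close> makes the right-hand side vanish.\<close>

lemma max_excess_ge_spread:
  fixes x :: "'e \<Rightarrow> real" and \<Delta> :: "'e \<Rightarrow> real"
  assumes fin: "finite E" "finite F" and B: "\<And>f. f \<in> F \<Longrightarrow> B f \<subseteq> E \<and> B f \<noteq> {}"
    and total: "(\<Sum>e\<in>E. \<Delta> e) = c * real (card F)"
    and gap: "\<And>U. U \<subseteq> E \<Longrightarrow> U \<noteq> {} \<Longrightarrow> U \<noteq> E \<Longrightarrow>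
      (\<Sum>e\<in>U. \<Delta> e) + \<epsilon> \<le> c * real (card {f\<in>F. B f \<inter> U \<noteq> {}})"
    and "0 \<le> \<epsilon>" "a \<in> E" "b \<in> E"
  shows "\<epsilon> * (x a - x b) \<le> c * (\<Sum>f\<in>F. Max (x ` B f)) - (\<Sum>e\<in>E. \<Delta> e * x e)"
proof (induction "card (x ` E)" arbitrary: x rule: less_induct)
  case less
  define M where "M = Max (x ` E)"
  have fB: "finite (B f)" if "f \<in> F" for f using B[OF that] fin finite_subset by blast
  have M_in: "M \<in> x ` E" and M_ge: "\<And>e. e \<in> E \<Longrightarrow> x e \<le> M"
    unfolding M_def using fin \<open>a \<in> E\<close> by (auto intro!: Max_in)
  show ?case
  proof (cases "x ` E = {M}")
    case True
    then have xM: "x e = M" if "e \<in> E" for e using that by auto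
    have "x ` B f = {M}" if "f \<in> F" for f
      using B[OF that] xM by auto
    then have "(\<Sum>f\<in>F. Max (x ` B f)) = real (card F) * M" by simp
    moreover have "(\<Sum>e\<in>E. \<Delta> e * x e) = (\<Sum>e\<in>E. \<Delta> e) * M"
      using xM by (simp add: sum_distrib_right)
    ultimately show ?thesis using xM \<open>a \<in> E\<close> \<open>b \<in> E\<close> by (simp add: total)
  next
    case False
    \<comment> \<open>Lower the top level set \<open>U\<close> of \<open>x\<close> to the second largest value \<open>v\<close>.\<close>
    let ?R = "x ` E - {M}"
    have R: "finite ?R" "?R \<noteq> {}" using False M_in fin by auto
    define v where "v = Max ?R"
    have v_in: "v \<in> ?R" and v_ge: "\<And>y. y \<in> ?R \<Longrightarrow> y \<le> v"
      unfolding v_def using Max_in[OF R] Max_ge[OF R(1)] by blast+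
    have vM: "v < M" using v_in M_ge by force
    define U where "U = {e\<in>E. x e = M}"
    have U: "U \<subseteq> E" "U \<noteq> {}" "U \<noteq> E"
      using M_in v_in by (auto simp: U_def)
    define x' where "x' e = min (x e) v" for e
    have x': "x' e = (if e \<in> U then x e - (M - v) else x e)" if "e \<in> E" for e
      using that vM v_ge[of "x e"] by (auto simp: x'_def U_def)
    \<comment> \<open>The value \<open>M\<close> disappears and no new value arises, so the
      induction hypothesis applies to \<open>x'\<close>.\<close>
    have "x' ` E \<subseteq> ?R"
    proof
      fix z assume "z \<in> x' ` E"
      then obtain e where e: "e \<in> E" "z = min (x e) v" by (auto simp: x'_def)
      show "z \<in> ?R"
      proof (cases "x e = M")
        case True
        then show ?thesis using e vM v_in by simp
      next
        case False
        then show ?thesis using e v_ge[of "x e"] by simp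
      qed
    qed
    then have "card (x' ` E) < card (x ` E)"
      using card_mono[OF R(1)] M_in fin by (meson card_Diff1_less finite_imageI le_less_trans)
    from less[OF this]
    have IH: "\<epsilon> * (x' a - x' b) \<le> c * (\<Sum>f\<in>F. Max (x' ` B f)) - (\<Sum>e\<in>E. \<Delta> e * x' e)" .
    let ?T = "{f\<in>F. B f \<inter> U \<noteq> {}}"
    \<comment> \<open>The count of blocks meeting \<open>U\<close> in \<open>gap\<close> enters
      here: truncation lowers the maximum on precisely these blocks.\<close>
    have Max_x: "Max (x ` B f) = Max (x' ` B f) + (if f \<in> ?T then M - v else 0)" if f: "f \<in> F" for f
    proof (cases "f \<in> ?T")
      case True
      then obtain e where e: "e \<in> B f" "x e = M" "e \<in> E" using B[OF f] by (auto simp: U_def)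
      have "Max (x ` B f) = M"
        using e fB[OF f] M_ge B[OF f] by (intro Max_eqI) force+
      moreover have "Max (x' ` B f) = v"
        using e fB[OF f] vM by (intro Max_eqI) (force simp: x'_def)+
      ultimately show ?thesis using True by simp
    next
      case False
      then have "x' ` B f = x ` B f"
        using x' B[OF f] f by (intro image_cong) (auto simp: disjoint_iff)
      then show ?thesis using False by (simp only: if_False add_0_right)
    qed
    have "(\<Sum>f\<in>F. Max (x ` B f)) = (\<Sum>f\<in>F. Max (x' ` B f)) + real (card ?T) * (M - v)"
      using fin Max_x by (simp add: sum.distrib sum.If_cases Int_def conj_commute)
    then have "c * (\<Sum>f\<in>F. Max (x ` B f)) =
        c * (\<Sum>f\<in>F. Max (x' ` B f)) + c * real (card ?T) * (M - v)"
      by (simp add: distrib_left)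
    moreover have "(\<Sum>e\<in>E. \<Delta> e * x e) = (\<Sum>e\<in>E. \<Delta> e * x' e) + (\<Sum>e\<in>U. \<Delta> e) * (M - v)"
    proof -
      have "(\<Sum>e\<in>E. \<Delta> e * x e) = (\<Sum>e\<in>E. \<Delta> e * x' e + (if e \<in> U then \<Delta> e * (M - v) else 0))"
        by (intro sum.cong) (auto simp: x' algebra_simps)
      also have "\<dots> = (\<Sum>e\<in>E. \<Delta> e * x' e) + (\<Sum>e\<in>E \<inter> U. \<Delta> e * (M - v))"
        using fin by (simp add: sum.distrib sum.inter_restrict)
      finally show ?thesis using U by (simp add: Int_absorb1 sum_distrib_right)
    qed
    moreover have "((\<Sum>e\<in>U. \<Delta> e) + \<epsilon>) * (M - v) \<le> c * real (card ?T) * (M - v)"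
      using gap[OF U] vM by (intro mult_right_mono) auto
    \<comment> \<open>Truncation shrinks the difference by at most \<open>M - v\<close>, which the
      \<open>\<epsilon>\<close> in \<open>gap\<close> pays for.\<close>
    moreover have "\<epsilon> * (x a - x b) \<le> \<epsilon> * (x' a - x' b) + \<epsilon> * (M - v)"
    proof -
      have "x a - x b \<le> x' a - x' b + (M - v)"
        using x'[OF \<open>a \<in> E\<close>] x'[OF \<open>b \<in> E\<close>] vM by (auto split: if_splits)
      from mult_left_mono[OF this \<open>0 \<le> \<epsilon>\<close>] show ?thesis by (simp add: distrib_left)
    qed
    ultimately show ?thesis using IH by (simp add: algebra_simps)
  qed
qed

section \<open>Counting sides, edges and faces\<close>

lemma sum_sides: "finite \<FF> \<Longrightarrow> (\<Sum>s\<in>sides \<FF>. \<phi> s) = (\<Sum>f\<in>\<FF>. \<phi> (f, 0) + \<phi> (f, 1) + \<phi> (f, 2))"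
proof -
  have "(\<Sum>s\<in>sides \<FF>. \<phi> s) = (\<Sum>f\<in>\<FF>. \<Sum>i\<in>{0, 1, 2}. \<phi> (f, i))"
    unfolding sides_def by (simp only: sum.cartesian_product case_prod_eta)
  then show ?thesis by (simp add: add.assoc)
qed

lemma edges_eq: "edges F gl = edges_of_faces gl F"
  by (simp add: edges_def edges_of_faces_def)

lemma edges_of_faces_mono: "\<FF> \<subseteq> \<GG> \<Longrightarrow> edges_of_faces gl \<FF> \<subseteq> edges_of_faces gl \<GG>"
  by (auto simp: edges_of_faces_def sides_def)

lemma edges_of_faces_UN: "edges_of_faces gl \<FF> = (\<Union>f\<in>\<FF>. edges_of_faces gl {f})"
  by (auto simp: edges_of_faces_def sides_def)

lemma edges_of_faces_empty_iff: "edges_of_faces gl \<FF> = {} \<longleftrightarrow> \<FF> = {}"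
  by (simp add: edges_of_faces_def sides_def)

section \<open>Edges as orbits of the gluing involution, and sums over them\<close>

context
  fixes F :: "'f set" and gl :: "'f side \<Rightarrow> 'f side option"
  assumes T: "triangulation F gl"
begin

lemma finite_faces: "finite F" and faces_nonempty: "F \<noteq> {}"
  using T by (auto simp: triangulation_def)

lemma glued: "gl s = Some t \<Longrightarrow> s \<in> sides F \<and> t \<in> sides F \<and> t \<noteq> s \<and> gl t = Some s"
  using T unfolding triangulation_def by blast

lemma edge_of_eq: "t \<in> edge_of gl s \<Longrightarrow> edge_of gl t = edge_of gl s"
  using glued[of s t] by (auto simp: edge_of_def)

lemma edge_of_subset: "s \<in> sides F \<Longrightarrow> edge_of gl s \<subseteq> sides F"
  using glued[of s] by (auto simp: edge_of_def)

lemma finite_edge_of: "finite (edge_of gl s)"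
  by (simp add: edge_of_def)

lemma card_edge_of: "card (edge_of gl s) \<le> 2"
  by (cases "gl s") (auto simp: edge_of_def card_insert_if)

lemma finite_sides: "finite (sides F)"
  using finite_faces by (simp add: sides_def)

lemma finite_edges: "finite (edges F gl)"
  using finite_sides by (simp add: edges_def)

lemma card_sides: "card (sides F) = 3 * card F"
  using finite_faces by (simp add: sides_def card_cartesian_product mult.commute)

lemma Union_edges: "\<Union>(edges F gl) = sides F"
  using edge_of_subset by (auto simp: edges_def) (auto simp: edge_of_def)

lemma edgeE:
  assumes "e \<in> edges F gl" "s \<in> e"
  shows "e = edge_of gl s" "s \<in> sides F"
proof -
  obtain t where t: "t \<in> sides F" "e = edge_of gl t" using assms by (auto simp: edges_def)
  show "e = edge_of gl s" using assms t edge_of_eq by blast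
  show "s \<in> sides F" using assms t edge_of_subset by blast
qed

text \<open>Edges are orbits of the gluing, hence pairwise disjoint, so each side is counted once.
  The sides on the right may belong to faces outside \<open>\<FF>\<close>.\<close>

lemma sum_over_edges:
  assumes "\<FF> \<subseteq> F"
  shows "(\<Sum>e\<in>edges_of_faces gl \<FF>. \<Sum>s\<in>e. \<phi> s) = (\<Sum>s\<in>\<Union>(edges_of_faces gl \<FF>). \<phi> s)"
proof -
  have sub: "edges_of_faces gl \<FF> \<subseteq> edges F gl"
    using assms by (simp add: edges_eq edges_of_faces_mono)
  have "finite e" if "e \<in> edges_of_faces gl \<FF>" for e
    using that finite_edge_of by (auto simp: edges_of_faces_def)
  moreover have "A \<inter> B = {}" if "A \<in> edges F gl" "B \<in> edges F gl" "A \<noteq> B" for A B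
    using edgeE(1)[OF that(1)] edgeE(1)[OF that(2)] that(3) by blast
  ultimately show ?thesis
    using sub by (subst sum.Union_disjoint) (auto simp: subset_iff)
qed

lemma sum_over_all_edges:
  "(\<Sum>e\<in>edges F gl. \<Sum>s\<in>e. \<phi> s) = (\<Sum>f\<in>F. \<phi> (f, 0) + \<phi> (f, 1) + \<phi> (f, 2))"
  using sum_over_edges[of F \<phi>] by (simp add: Union_edges sum_sides finite_faces flip: edges_eq)

text \<open>Connectedness of the surface enters here: no gluing leads out of \<open>\<FF>\<close>,
  so reachability in the dual graph carries a single face of \<open>\<FF>\<close> to all of
  \<open>F\<close>.\<close>

lemma glue_closed_faces:
  assumes "\<FF> \<subseteq> F" "\<Union>(edges_of_faces gl \<FF>) \<subseteq> sides \<FF>"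
  shows "\<FF> = {} \<or> \<FF> = F"
proof (rule disjCI)
  assume "\<FF> \<noteq> F"
  show "\<FF> = {}"
  proof (rule ccontr)
    assume "\<FF> \<noteq> {}"
    then obtain f where f: "f \<in> \<FF>" by blast
    have step: "g' \<in> \<FF>" if g: "g \<in> \<FF>" and adj: "dual_adj gl g g'" for g g'
    proof -
      obtain i t where i: "i < 3" "gl (g, i) = Some t" "fst t = g'"
        using adj by (auto simp: dual_adj_def)
      then have "(g, i) \<in> sides \<FF>" using g by (auto simp: sides_def)
      then have "t \<in> \<Union>(edges_of_faces gl \<FF>)"
        using i by (auto simp: edges_of_faces_def edge_of_def intro!: bexI[of _ "(g, i)"])
      then show ?thesis using assms(2) i by (auto simp: sides_def)
    qed
    have "g \<in> \<FF>" if "(dual_adj gl)\<^sup>*\<^sup>* f g" for g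
      using that by induction (use f step in auto)
    then have "F \<subseteq> \<FF>"
      using T f assms(1) unfolding triangulation_def by blast
    then show False using assms(1) \<open>\<FF> \<noteq> F\<close> by blast
  qed
qed

text \<open>Double counting: the edges of \<open>\<FF>\<close> contain all sides of
  \<open>\<FF>\<close>, which contribute \<open>c\<close> per face, and perhaps sides of
  neighbouring faces, which add a positive surplus. Without surplus, \<open>\<FF>\<close> is closed
  under gluing.\<close>

lemma angle_sum_over_faces:
  fixes \<phi> :: "'f side \<Rightarrow> real"
  assumes pos: "\<And>s. s \<in> sides F \<Longrightarrow> 0 < \<phi> s"
    and face: "\<And>f. f \<in> F \<Longrightarrow> \<phi> (f, 0) + \<phi> (f, 1) + \<phi> (f, 2) = c"
    and sub: "\<FF> \<subseteq> F"
  shows "c * real (card \<FF>) \<le> (\<Sum>e\<in>edges_of_faces gl \<FF>. \<Sum>s\<in>e. \<phi> s)"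
    and "(\<Sum>e\<in>edges_of_faces gl \<FF>. \<Sum>s\<in>e. \<phi> s) = c * real (card \<FF>) \<longleftrightarrow>
      \<FF> = F \<or> edges_of_faces gl \<FF> = {}"
proof -
  let ?S = "\<Union>(edges_of_faces gl \<FF>)"
  have fin: "finite \<FF>" using sub finite_faces by (rule finite_subset)
  have S: "?S \<subseteq> sides F" "sides \<FF> \<subseteq> ?S"
    using Union_mono[OF edges_of_faces_mono[OF sub, of gl]] Union_edges
    by (simp add: edges_eq, force simp: edges_of_faces_def edge_of_def)
  then have fS: "finite ?S" using finite_sides by (auto intro: finite_subset)
  have c: "c * real (card \<FF>) = (\<Sum>s\<in>sides \<FF>. \<phi> s)"
    using fin sub face by (simp add: sum_sides subset_iff)
  have nn: "\<forall>s\<in>?S. 0 \<le> \<phi> s" using S pos by force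
  show le: "c * real (card \<FF>) \<le> (\<Sum>e\<in>edges_of_faces gl \<FF>. \<Sum>s\<in>e. \<phi> s)"
    unfolding c sum_over_edges[OF sub] using S fS nn by (intro sum_mono2) auto
  show "(\<Sum>e\<in>edges_of_faces gl \<FF>. \<Sum>s\<in>e. \<phi> s) = c * real (card \<FF>) \<longleftrightarrow>
      \<FF> = F \<or> edges_of_faces gl \<FF> = {}"
  proof
    assume "(\<Sum>e\<in>edges_of_faces gl \<FF>. \<Sum>s\<in>e. \<phi> s) = c * real (card \<FF>)"
    then have eq: "(\<Sum>s\<in>?S. \<phi> s) = (\<Sum>s\<in>sides \<FF>. \<phi> s)"
      by (simp only: c sum_over_edges[OF sub])
    have "?S \<subseteq> sides \<FF>"
    proof (rule ccontr)
      assume "\<not> ?S \<subseteq> sides \<FF>"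
      then obtain t where t: "t \<in> ?S - sides \<FF>" by blast
      then have "0 < \<phi> t" using S pos by blast
      have "(\<Sum>s\<in>sides \<FF>. \<phi> s) < (\<Sum>s\<in>?S. \<phi> s)"
        using fS S(2) t \<open>0 < \<phi> t\<close> nn by (intro sum_strict_mono2[of _ _ t]) auto
      then show False using eq by simp
    qed
    from glue_closed_faces[OF sub this] show "\<FF> = F \<or> edges_of_faces gl \<FF> = {}"
      by (auto simp: edges_of_faces_empty_iff)
  next
    assume "\<FF> = F \<or> edges_of_faces gl \<FF> = {}"
    then show "(\<Sum>e\<in>edges_of_faces gl \<FF>. \<Sum>s\<in>e. \<phi> s) = c * real (card \<FF>)"
    proof
      assume "\<FF> = F"
      then show ?thesis using face sum_over_all_edges[of \<phi>] by (simp add: edges_eq)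
    next
      assume "edges_of_faces gl \<FF> = {}"
      moreover from this have "\<FF> = {}" by (simp add: edges_of_faces_empty_iff)
      ultimately show ?thesis by simp
    qed
  qed
qed

text \<open>Passes from sets of faces to sets of edges, the form that superlevel sets call for.
  Subtracting the inequality for the avoiding faces from the total over all edges leaves the
  claim.\<close>

lemma gap_of_face_condition:
  fixes \<Delta> :: "'f side set \<Rightarrow> real"
  assumes pos: "\<And>e. e \<in> edges F gl \<Longrightarrow> 0 < \<Delta> e"
    and le: "\<And>\<FF>. \<FF> \<subseteq> F \<Longrightarrow> c * real (card \<FF>) \<le> (\<Sum>e\<in>edges_of_faces gl \<FF>. \<Delta> e)"
    and eq: "\<And>\<FF>. \<FF> \<subseteq> F \<Longrightarrow>
      (\<Sum>e\<in>edges_of_faces gl \<FF>. \<Delta> e) = c * real (card \<FF>) \<longleftrightarrow>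
        \<FF> = F \<or> edges_of_faces gl \<FF> = {}"
    and U: "U \<subseteq> edges F gl" "U \<noteq> {}" "U \<noteq> edges F gl"
  shows "(\<Sum>e\<in>U. \<Delta> e) < c * real (card {f\<in>F. edges_of_faces gl {f} \<inter> U \<noteq> {}})"
proof -
  let ?E = "edges F gl"
  \<comment> \<open>Apply the face condition to the faces that avoid \<open>U\<close>.\<close>
  define \<FF> where "\<FF> = {f\<in>F. edges_of_faces gl {f} \<inter> U = {}}"
  have sub: "\<FF> \<subseteq> F" by (auto simp: \<FF>_def)
  have EU: "edges_of_faces gl \<FF> \<inter> U = {}"
    by (subst edges_of_faces_UN) (auto simp: \<FF>_def)
  have "{f\<in>F. edges_of_faces gl {f} \<inter> U \<noteq> {}} = F - \<FF>" by (auto simp: \<FF>_def)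
  then have card: "real (card {f\<in>F. edges_of_faces gl {f} \<inter> U \<noteq> {}}) = real (card F) - real (card \<FF>)"
    using sub finite_faces by (simp add: card_Diff_subset finite_subset of_nat_diff card_mono)
  have total: "(\<Sum>e\<in>?E. \<Delta> e) = c * real (card F)"
    using eq[of F] by (simp add: edges_eq)
  have split: "(\<Sum>e\<in>?E. \<Delta> e) = (\<Sum>e\<in>U. \<Delta> e) + (\<Sum>e\<in>?E - U. \<Delta> e)"
    using U finite_edges by (simp add: sum.subset_diff)
  have sub': "edges_of_faces gl \<FF> \<subseteq> ?E - U"
    using EU edges_of_faces_mono[OF sub, of gl] by (auto simp: edges_eq)
  have "c * real (card \<FF>) < (\<Sum>e\<in>?E - U. \<Delta> e)"
  \<comment> \<open>If no face avoids \<open>U\<close>, the face inequality only says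
    \<open>0 \<le> 0\<close>, and strictness comes from positivity of \<open>\<Delta>\<close> on the
    nonempty rest \<open>?E - U\<close>.\<close>
  proof (cases "\<FF> = {}")
    case True
    then show ?thesis
      using U pos finite_edges by (auto intro!: sum_pos)
  next
    case False
    have "\<FF> \<noteq> F"
      using U sub' by (auto simp: edges_eq)
    with False have "c * real (card \<FF>) \<noteq> (\<Sum>e\<in>edges_of_faces gl \<FF>. \<Delta> e)"
      using eq[OF sub] by (auto simp: edges_of_faces_empty_iff)
    then have "c * real (card \<FF>) < (\<Sum>e\<in>edges_of_faces gl \<FF>. \<Delta> e)"
      using le[OF sub] by simp
    also have "\<dots> \<le> (\<Sum>e\<in>?E - U. \<Delta> e)"
      using sub' finite_edges pos by (intro sum_mono2) (auto intro: less_imp_le)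
    finally show ?thesis .
  qed
  then show ?thesis using total split by (simp add: card algebra_simps)
qed

text \<open>An angle \<open>c\<close> in a degenerate face exhausts its edge, so all sides of that edge lie in degenerate
  faces. Hence the set \<open>Z\<close> of these edges touches at most \<open>|Z|\<close> faces, against the gap inequality.\<close>

lemma no_degenerate_face:
  fixes \<Delta> :: "'f side set \<Rightarrow> real" and \<phi> :: "'f side \<Rightarrow> real"
  assumes nonneg: "\<And>s. s \<in> sides F \<Longrightarrow> 0 \<le> \<phi> s"
    and face: "\<And>f. f \<in> F \<Longrightarrow> \<phi> (f, 0) + \<phi> (f, 1) + \<phi> (f, 2) = c"
    and "0 < c"
    and edge: "\<And>e. e \<in> edges F gl \<Longrightarrow> (\<Sum>s\<in>e. \<phi> s) = \<Delta> e \<and> \<Delta> e \<le> c"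
    and gap: "\<And>U. U \<subseteq> edges F gl \<Longrightarrow> U \<noteq> {} \<Longrightarrow> U \<noteq> edges F gl \<Longrightarrow>
      (\<Sum>e\<in>U. \<Delta> e) < c * real (card {f\<in>F. edges_of_faces gl {f} \<inter> U \<noteq> {}})"
    and degenerate: "\<And>f i. (f, i) \<in> sides F \<Longrightarrow> \<phi> (f, i) = 0 \<Longrightarrow> \<exists>j. (f, j) \<in> sides F \<and> \<phi> (f, j) = c"
    and "s \<in> sides F"
  shows "0 < \<phi> s"
proof (rule ccontr)
  assume "\<not> 0 < \<phi> s"
  then have "\<phi> s = 0" using nonneg[OF \<open>s \<in> sides F\<close>] by simp
  define P where "P = {s \<in> sides F. \<phi> s = c}"
  define Z where "Z = edge_of gl ` P"
  have finP: "finite P" using finite_sides by (simp add: P_def)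
  have "P \<noteq> {}"
    using degenerate[of "fst s" "snd s"] \<open>\<phi> s = 0\<close> \<open>s \<in> sides F\<close> by (auto simp: P_def)
  have only: "\<phi> t = 0 \<and> edge_of gl s = edge_of gl t"
    \<comment> \<open>An edge has at most two sides and total at most \<open>c\<close>, so a side
      with angle \<open>c\<close> leaves 0 for its partner.\<close>
    if "s \<in> P" "t \<in> edge_of gl s" "t \<noteq> s" for s t
  proof -
    have s: "s \<in> sides F" "\<phi> s = c" using that by (auto simp: P_def)
    have "edge_of gl s = {s, t}" using that by (auto simp: edge_of_def)
    moreover have "edge_of gl s \<in> edges F gl" using s by (simp add: edges_def)
    moreover have "0 \<le> \<phi> t" using edge_of_subset[OF s(1)] that nonneg by blast
    ultimately show ?thesis using edge[of "edge_of gl s"] that s edge_of_eq[of t s] by auto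
  qed
  have inj: "inj_on (edge_of gl) P"
  proof (rule inj_onI, rule ccontr)
    fix s t assume st: "s \<in> P" "t \<in> P" "edge_of gl s = edge_of gl t" "s \<noteq> t"
    then have "t \<in> edge_of gl s" by (auto simp: edge_of_def)
    from only[OF st(1) this] st \<open>0 < c\<close> show False by (auto simp: P_def)
  qed
  have fst_inj: "inj_on fst P"
  proof (rule inj_onI, rule ccontr)
    fix s t assume st: "s \<in> P" "t \<in> P" "fst s = fst t" "s \<noteq> t"
    obtain f i j where fij: "s = (f, i)" "t = (f, j)" using st by (cases s; cases t) auto
    have "f \<in> F" "i \<in> {0,1,2}" "j \<in> {0,1,2}" "i \<noteq> j" "\<phi> (f, i) = c" "\<phi> (f, j) = c"
      using st fij by (auto simp: P_def sides_def)
    moreover have "0 \<le> \<phi> (f, 0)" "0 \<le> \<phi> (f, 1)" "0 \<le> \<phi> (f, 2)"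
      using \<open>f \<in> F\<close> nonneg by (auto simp: sides_def)
    ultimately show False using face[of f] \<open>0 < c\<close> by auto
  qed
  have "Z \<subseteq> edges F gl" by (auto simp: Z_def P_def edges_def)
  have "\<Delta> e = c" if e: "e \<in> Z" for e
  proof -
    obtain s where s: "s \<in> P" "e = edge_of gl s" using e unfolding Z_def by blast
    have "(\<Sum>t\<in>e. \<phi> t) = (\<Sum>t\<in>{s}. \<phi> t)"
      using only[OF s(1)] s finite_edge_of by (intro sum.mono_neutral_right) (auto simp: edge_of_def)
    then show ?thesis using s edge[of e] e \<open>Z \<subseteq> edges F gl\<close> by (auto simp: P_def)
  qed
  then have sumZ: "(\<Sum>e\<in>Z. \<Delta> e) = c * real (card P)"
    using inj by (simp add: Z_def card_image)
  \<comment> \<open>A face touching \<open>Z\<close> either owns the side of angle \<open>c\<close>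
    or owns its partner, whose angle 0 makes the face degenerate; either way it has a side in
    \<open>P\<close>.\<close>
  have "{f\<in>F. edges_of_faces gl {f} \<inter> Z \<noteq> {}} \<subseteq> fst ` P"
  proof
    fix f assume "f \<in> {f\<in>F. edges_of_faces gl {f} \<inter> Z \<noteq> {}}"
    then obtain i s where f: "f \<in> F" and i: "(f, i) \<in> sides F" "s \<in> P" "edge_of gl (f, i) = edge_of gl s"
      by (auto simp: edges_of_faces_def Z_def sides_def)
    show "f \<in> fst ` P"
    proof (cases "(f, i) = s")
      case True
      then show ?thesis using i by force
    next
      case False
      moreover have "(f, i) \<in> edge_of gl s" using i(3) by (auto simp: edge_of_def)
      ultimately have "\<phi> (f, i) = 0" using only[OF i(2)] by blast
      then obtain j where "(f, j) \<in> P" using degenerate[OF i(1)] by (auto simp: P_def)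
      then show ?thesis by force
    qed
  qed
  then have "real (card {f\<in>F. edges_of_faces gl {f} \<inter> Z \<noteq> {}}) \<le> real (card P)"
    using surj_card_le[OF finP] by simp
  then have "\<not> (\<Sum>e\<in>Z. \<Delta> e) < c * real (card {f\<in>F. edges_of_faces gl {f} \<inter> Z \<noteq> {}})"
    using \<open>0 < c\<close> by (simp add: sumZ not_less)
  moreover have "Z \<noteq> {}" using \<open>P \<noteq> {}\<close> by (simp add: Z_def)
  ultimately have Z: "Z = edges F gl" using gap[OF \<open>Z \<subseteq> edges F gl\<close>] by blast
  \<comment> \<open>If \<open>Z\<close> consists of all edges, then one edge of at most two sides
    for each element of \<open>P\<close> covers all sides, while \<open>P\<close> has at most one
    side per face.\<close>
  have "3 * card F = card (\<Union>Z)" by (simp add: Z Union_edges card_sides)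
  also have "\<dots> = card (\<Union>s\<in>P. edge_of gl s)" by (simp add: Z_def)
  also have "\<dots> \<le> (\<Sum>s\<in>P. card (edge_of gl s))" using finP by (rule card_UN_le)
  also have "\<dots> \<le> (\<Sum>s\<in>P. 2)" using card_edge_of by (intro sum_mono) auto
  also have "\<dots> = 2 * card (fst ` P)" using fst_inj by (simp add: card_image)
  also have "\<dots> \<le> 2 * card F"
    using finite_faces by (intro mult_left_mono card_mono) (auto simp: P_def sides_def)
  finally show False using finite_faces faces_nonempty by (simp add: card_gt_0_iff)
qed

end

section \<open>Prescribing dihedral angles and holonomy\<close>

lemma continuous_on_tri_angle:
  assumes "continuous_on S f" "continuous_on S g" "continuous_on S k"
    and "\<And>x. x \<in> S \<Longrightarrow> 0 < f x" "\<And>x. x \<in> S \<Longrightarrow> 0 < g x"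
  shows "continuous_on S (\<lambda>x. tri_angle (f x) (g x) (k x))"
proof -
  have "2 * f x * g x \<noteq> 0" if "x \<in> S" for x
    using assms(4,5)[OF that] by simp
  then show ?thesis
    unfolding tri_angle_def cos_ratio_def using assms(1-3) by (intro continuous_intros) auto
qed

text \<open>With \<open>u\<close>, \<open>v\<close>, \<open>w\<close> as logarithms of lengths,
  \<open>ln (a / c)\<close> becomes the gap from \<open>u\<close> to the longest side, so angle
  times gap stays bounded however thin the triangle is.\<close>

lemma tri_angle_mult_log_gap:
  "tri_angle (exp v) (exp w) (exp u) * (max u (max v w) - u) \<le> 2 * pi"
proof -
  have *: "tri_angle (exp v) (exp w) (exp u) * (v - u) \<le> 2 * pi" if "u \<le> v" for v w
    using tri_angle_mult_ln_le[of "exp v" "exp w" "exp u"] that by (simp add: ln_div)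
  consider "max u (max v w) = u" | "max u (max v w) = v" "u \<le> v" | "max u (max v w) = w" "u \<le> w"
    by linarith
  then show ?thesis
  proof cases
    case 2
    then show ?thesis using *[of v w] by simp
  next
    case 3
    then show ?thesis using *[of w v] by (simp add: tri_angle_commute)
  qed simp
qed

text \<open>The pairing of angles with log lengths falls short of \<pi> times the largest one by at
  most \<open>2 * pi\<close> per angle. Passing from \<open>u\<close>, \<open>v\<close>,
  \<open>w\<close> to \<open>x\<close>, \<open>y\<close>, \<open>z\<close> costs
  \<open>pi * H\<close> in the pairing and \<open>pi * H\<close> in the maximum.\<close>

lemma angle_weighted_sum_ge:
  fixes u v w :: real
  defines "\<alpha> \<equiv> tri_angle (exp v) (exp w) (exp u)"
    and "\<beta> \<equiv> tri_angle (exp w) (exp u) (exp v)"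
    and "\<gamma> \<equiv> tri_angle (exp u) (exp v) (exp w)"
  assumes x: "\<bar>x - u\<bar> \<le> H" and y: "\<bar>y - v\<bar> \<le> H" and z: "\<bar>z - w\<bar> \<le> H"
  shows "pi * Max {x, y, z} - (6 * pi + 2 * pi * H) \<le> \<alpha> * x + \<beta> * y + \<gamma> * z"
proof -
  define m where "m = max u (max v w)"
  have sum: "\<alpha> + \<beta> + \<gamma> = pi"
    using tri_angle_sum[of "exp v" "exp w" "exp u"] by (simp add: \<alpha>_def \<beta>_def \<gamma>_def)
  have "\<alpha> * (m - u) \<le> 2 * pi" "\<beta> * (m - v) \<le> 2 * pi" "\<gamma> * (m - w) \<le> 2 * pi"
    using tri_angle_mult_log_gap[of v w u] tri_angle_mult_log_gap[of w u v] tri_angle_mult_log_gap[of u v w]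
    by (simp_all add: \<alpha>_def \<beta>_def \<gamma>_def m_def max.commute max.left_commute)
  then have "(\<alpha> + \<beta> + \<gamma>) * m - 6 * pi \<le> \<alpha> * u + \<beta> * v + \<gamma> * w"
    by (simp add: algebra_simps)
  moreover have "\<alpha> * (u - H) \<le> \<alpha> * x" "\<beta> * (v - H) \<le> \<beta> * y" "\<gamma> * (w - H) \<le> \<gamma> * z"
    using x y z tri_angle_bounds(1) by (auto simp: \<alpha>_def \<beta>_def \<gamma>_def intro!: mult_left_mono)
  then have "\<alpha> * u + \<beta> * v + \<gamma> * w - (\<alpha> + \<beta> + \<gamma>) * H \<le> \<alpha> * x + \<beta> * y + \<gamma> * z"
    by (simp add: algebra_simps)
  moreover have "pi * Max {x, y, z} \<le> pi * (m + H)"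
    using x y z by (intro mult_left_mono) (auto simp: m_def)
  ultimately show ?thesis unfolding sum by (simp add: algebra_simps)
qed

section \<open>Clamped angles on the faces of the triangulation\<close>

definition ext_angle :: "('f side \<Rightarrow> real) \<Rightarrow> 'f side \<Rightarrow> real" where
  "ext_angle l s = tri_angle (l (fst s, (snd s + 1) mod 3)) (l (fst s, (snd s + 2) mod 3)) (l s)"

lemma mod3:
  "((0::nat) + 1) mod 3 = 1" "((0::nat) + 2) mod 3 = 2" "((1::nat) + 1) mod 3 = 2"
  "((1::nat) + 2) mod 3 = 0" "((2::nat) + 1) mod 3 = 0" "((2::nat) + 2) mod 3 = 1"
  by simp_all

lemma ext_angle_simps:
  "ext_angle l (f, 0) = tri_angle (l (f, 1)) (l (f, 2)) (l (f, 0))"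
  "ext_angle l (f, 1) = tri_angle (l (f, 2)) (l (f, 0)) (l (f, 1))"
  "ext_angle l (f, 2) = tri_angle (l (f, 0)) (l (f, 1)) (l (f, 2))"
  unfolding ext_angle_def fst_conv snd_conv mod3 by (rule refl)+

lemma opp_angle_simps:
  "opp_angle l (f, 0) = arccos (cos_ratio (l (f, 1)) (l (f, 2)) (l (f, 0)))"
  "opp_angle l (f, 1) = arccos (cos_ratio (l (f, 2)) (l (f, 0)) (l (f, 1)))"
  "opp_angle l (f, 2) = arccos (cos_ratio (l (f, 0)) (l (f, 1)) (l (f, 2)))"
  unfolding opp_angle_def cos_ratio_def Let_def fst_conv snd_conv mod3 by (rule refl)+

lemma euclidean_triangle_iff:
  "euclidean_triangle l f \<longleftrightarrow> 0 < l (f, 0) \<and> 0 < l (f, 1) \<and> 0 < l (f, 2) \<and>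
     l (f, 0) < l (f, 1) + l (f, 2) \<and> l (f, 1) < l (f, 2) + l (f, 0) \<and> l (f, 2) < l (f, 0) + l (f, 1)"
proof -
  have *: "(\<forall>i<3. P i) \<longleftrightarrow> P 0 \<and> P 1 \<and> P 2" for P :: "nat \<Rightarrow> bool"
    by (auto simp: eval_nat_numeral All_less_Suc)
  show ?thesis unfolding euclidean_triangle_def * mod3 by (intro iffI conjI; elim conjE; linarith)
qed

text \<open>Strict triangle inequalities keep the cosine strictly between -1 and 1, so the clamp is
  inactive and the angle is positive.\<close>

lemma opp_angle_euclidean:
  assumes "euclidean_triangle l f" "s \<in> sides {f}"
  shows "opp_angle l s = ext_angle l s" "0 < ext_angle l s"
proof -
  note E = assms(1)[unfolded euclidean_triangle_iff]
  consider "s = (f, 0)" | "s = (f, 1)" | "s = (f, 2)" using assms(2) by (auto simp: sides_def)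
  then have "opp_angle l s = ext_angle l s \<and> 0 < ext_angle l s"
  proof cases
    case 1
    show ?thesis unfolding 1 opp_angle_simps ext_angle_simps
      using E tri_angle_nondegenerate[of "l (f, 1)" "l (f, 2)" "l (f, 0)"] by linarith
  next
    case 2
    show ?thesis unfolding 2 opp_angle_simps ext_angle_simps
      using E tri_angle_nondegenerate[of "l (f, 2)" "l (f, 0)" "l (f, 1)"] by linarith
  next
    case 3
    show ?thesis unfolding 3 opp_angle_simps ext_angle_simps
      using E tri_angle_nondegenerate[of "l (f, 0)" "l (f, 1)" "l (f, 2)"] by linarith
  qed
  then show "opp_angle l s = ext_angle l s" "0 < ext_angle l s" by auto
qed

lemma sum_ext_angle:
  assumes "0 < l (f, 0)" "0 < l (f, 1)" "0 < l (f, 2)"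
  shows "ext_angle l (f, 0) + ext_angle l (f, 1) + ext_angle l (f, 2) = pi"
  unfolding ext_angle_simps using tri_angle_sum[OF assms(2,3,1)] by linarith

lemma ext_angle_degenerate:
  assumes "0 < l (f, 0)" "0 < l (f, 1)" "0 < l (f, 2)" "\<not> euclidean_triangle l f"
  shows "\<exists>j\<in>{0, 1, 2}. ext_angle l (f, j) = pi"
proof -
  consider "l (f, 1) + l (f, 2) \<le> l (f, 0)" | "l (f, 2) + l (f, 0) \<le> l (f, 1)"
    | "l (f, 0) + l (f, 1) \<le> l (f, 2)"
    using assms unfolding euclidean_triangle_iff by linarith
  then show ?thesis
    using assms(1-3) tri_angle_eq_pi unfolding ext_angle_simps(1)[symmetric]
    by cases (metis ext_angle_simps insertCI)+
qed

text \<open>Coercivity rules out that the solution of the variational inequality touches the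
  boundary of a large box, and in the interior every component of \<open>G\<close> vanishes.\<close>

lemma realize_dihedral_angles:
  fixes \<Delta> :: "'f side set \<Rightarrow> real" and h :: "'f side \<Rightarrow> real"
  assumes T: "triangulation F gl"
    and gap: "\<And>U. U \<subseteq> edges F gl \<Longrightarrow> U \<noteq> {} \<Longrightarrow> U \<noteq> edges F gl \<Longrightarrow>
      (\<Sum>e\<in>U. \<Delta> e) < pi * real (card {f\<in>F. edges_of_faces gl {f} \<inter> U \<noteq> {}})"
    and total: "(\<Sum>e\<in>edges F gl. \<Delta> e) = pi * real (card F)"
  obtains x where "\<And>e. e \<in> edges F gl \<Longrightarrow>
    (\<Sum>s\<in>e. ext_angle (\<lambda>s. exp (x (edge_of gl s) - h s)) s) = \<Delta> e"
proof -
  let ?E = "edges F gl"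
  let ?B = "\<lambda>f. edges_of_faces gl {f}"
  note [simp] = finite_faces[OF T] finite_edges[OF T] finite_sides[OF T]
  have B: "?B f = {edge_of gl (f, 0), edge_of gl (f, 1), edge_of gl (f, 2)}" for f
    by (simp add: edges_of_faces_def sides_def)
  have B_sub: "?B f \<subseteq> ?E \<and> ?B f \<noteq> {}" if "f \<in> F" for f
    using that edges_of_faces_mono[of "{f}" F gl] by (simp add: edges_eq edges_of_faces_empty_iff)
  obtain \<epsilon> where "0 < \<epsilon>" and \<epsilon>: "\<And>U. U \<subseteq> ?E \<Longrightarrow> U \<noteq> {} \<Longrightarrow> U \<noteq> ?E \<Longrightarrow>
      (\<Sum>e\<in>U. \<Delta> e) + \<epsilon> \<le> pi * real (card {f\<in>F. ?B f \<inter> U \<noteq> {}})"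
  proof -
    define d where "d U = pi * real (card {f\<in>F. ?B f \<inter> U \<noteq> {}}) - (\<Sum>e\<in>U. \<Delta> e)" for U
    define \<U> where "\<U> = Pow ?E - {{}, ?E}"
    \<comment> \<open>There are finitely many sets of edges, so the strict inequalities have a
      common margin. Inserting 1 makes the minimum range over a nonempty set without counting
      edges.\<close>
    have fin: "finite (insert 1 (d ` \<U>))" by (simp add: \<U>_def)
    show thesis
    proof (rule that)
      show "0 < Min (insert 1 (d ` \<U>))"
        using fin gap by (subst Min_gr_iff) (auto simp: d_def \<U>_def)
      fix U assume "U \<subseteq> ?E" "U \<noteq> {}" "U \<noteq> ?E"
      then have "d U \<in> insert 1 (d ` \<U>)" by (auto simp: \<U>_def)
      from Min_le[OF fin this]
      show "(\<Sum>e\<in>U. \<Delta> e) + Min (insert 1 (d ` \<U>)) \<le> pi * real (card {f\<in>F. ?B f \<inter> U \<noteq> {}})"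
        by (simp add: d_def)
    qed
  qed
  define H where "H = (\<Sum>s\<in>sides F. \<bar>h s\<bar>)"
  have H: "\<bar>h s\<bar> \<le> H" if "s \<in> sides F" for s
    unfolding H_def using that by (intro member_le_sum) auto
  define C where "C = real (card F) * (6 * pi + 2 * pi * H)"
  define ang where "ang x = ext_angle (\<lambda>s. exp (x (edge_of gl s) - h s))" for x :: "'f side set \<Rightarrow> real"
  define G where "G x e = (\<Sum>s\<in>e. ang x s) - \<Delta> e" for x e
  have sumG: "(\<Sum>e\<in>?E. G x e) = 0" for x
    unfolding G_def sum_subtractf sum_over_all_edges[OF T] ang_def
    by (simp add: sum_ext_angle total del: One_nat_def)
  \<comment> \<open>The estimate for single faces is summed and its sides are regrouped by edges,
    which turns face maxima into the pairing of \<open>x\<close> with the angles; \<open>C\<close>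
    collects the errors of all faces.\<close>
  have coercive: "\<epsilon> * (x a - x b) - C \<le> (\<Sum>e\<in>?E. x e * G x e)" if ab: "a \<in> ?E" "b \<in> ?E" for x a b
  proof -
    have "\<epsilon> * (x a - x b) \<le> pi * (\<Sum>f\<in>F. Max (x ` ?B f)) - (\<Sum>e\<in>?E. \<Delta> e * x e)"
      using B_sub total \<epsilon> \<open>0 < \<epsilon>\<close> ab by (intro max_excess_ge_spread) auto
    moreover have "pi * (\<Sum>f\<in>F. Max (x ` ?B f)) - C =
        (\<Sum>f\<in>F. pi * Max (x ` ?B f) - (6 * pi + 2 * pi * H))"
      by (simp add: C_def sum_subtractf sum_distrib_left)
    moreover have "\<dots> \<le> (\<Sum>f\<in>F. ang x (f, 0) * x (edge_of gl (f, 0)) +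
        ang x (f, 1) * x (edge_of gl (f, 1)) + ang x (f, 2) * x (edge_of gl (f, 2)))"
      unfolding B ang_def ext_angle_simps image_insert image_empty
      by (intro sum_mono angle_weighted_sum_ge) (auto simp: sides_def intro!: H)
    moreover have "\<dots> = (\<Sum>e\<in>?E. \<Sum>s\<in>e. ang x s * x (edge_of gl s))"
      by (rule sum_over_all_edges[OF T, symmetric])
    moreover have "\<dots> = (\<Sum>e\<in>?E. x e * (\<Sum>s\<in>e. ang x s))"
      unfolding sum_distrib_left using edgeE(1)[OF T]
      by (intro sum.cong) (auto simp: mult.commute)
    moreover have "(\<Sum>e\<in>?E. x e * G x e) =
        (\<Sum>e\<in>?E. x e * (\<Sum>s\<in>e. ang x s)) - (\<Sum>e\<in>?E. \<Delta> e * x e)"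
      by (simp add: G_def right_diff_distrib sum_subtractf mult.commute)
    ultimately show ?thesis by linarith
  qed
  obtain b where b0: "bij_betw b {0..<card ?E} ?E"
    using ex_bij_betw_nat_finite[of ?E] by auto
  have "?E \<noteq> {}" using faces_nonempty[OF T] by (simp add: edges_eq edges_of_faces_empty_iff)
  \<comment> \<open>One edge is split off: adding a constant to \<open>x\<close> rescales all
    triangles and keeps their angles, so one coordinate can be normalized.\<close>
  then obtain n where n: "card ?E = Suc n"
    by (metis card_eq_0_iff finite_edges[OF T] not0_implies_Suc)
  with b0 have b: "bij_betw b {..<Suc n} ?E" by (simp add: atLeast0LessThan)
  then have b_in: "b j \<in> ?E" if "j \<le> n" for j using that by (auto simp: bij_betw_def)
  define X where "X y e = y (inv_into {..<Suc n} b e)" for y :: "nat \<Rightarrow> real" and e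
  have Xb: "X y (b j) = y j" if "j \<le> n" for y j
    using that b by (simp add: X_def bij_betw_inv_into_left)
  have cont: "continuous_on UNIV (\<lambda>y. G (X y) (b j))" for j
    unfolding G_def ang_def ext_angle_def X_def
    by (intro continuous_intros continuous_on_tri_angle) auto
  \<comment> \<open>The coordinate \<open>n\<close> is pinned to \<open>0\<close>; its equation follows from the others by \<open>sumG\<close>.\<close>
  define K where "K = (\<bar>C\<bar> + 1) / \<epsilon>"
  have "0 < K" using \<open>0 < \<epsilon>\<close> by (simp add: K_def)
  obtain y where yK: "\<And>i. \<bar>y i\<bar> \<le> K" and y0: "\<And>i. n \<le> i \<Longrightarrow> y i = 0"
    and lo: "\<And>i. i < n \<Longrightarrow> y i < K \<Longrightarrow> 0 \<le> G (X y) (b i)"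
    and hi: "\<And>i. i < n \<Longrightarrow> - K < y i \<Longrightarrow> G (X y) (b i) \<le> 0"
    using box_variational_inequality[of K n "\<lambda>y j. G (X y) (b j)"] \<open>0 < K\<close> cont by blast
  have reindex: "(\<Sum>e\<in>?E. k e) = (\<Sum>j<n. k (b j)) + k (b n)" for k :: "_ \<Rightarrow> real"
    using sum.reindex_bij_betw[OF b, of k] by simp
  \<comment> \<open>On the boundary of the box the sign of \<open>G\<close> is opposite to that of
    the coordinate, and in the interior \<open>G\<close> vanishes.\<close>
  have "y i * G (X y) (b i) \<le> 0" if "i < n" for i
  proof -
    consider "y i = K" | "y i = - K" | "- K < y i" "y i < K" using yK[of i] by linarith
    then show ?thesis
    proof cases
      case 1
      then show ?thesis using hi[OF that] \<open>0 < K\<close> by (simp add: mult_nonneg_nonpos)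
    next
      case 2
      then show ?thesis using lo[OF that] \<open>0 < K\<close> by simp
    next
      case 3
      then show ?thesis using lo[OF that] hi[OF that] by simp
    qed
  qed
  then have le0: "(\<Sum>e\<in>?E. X y e * G (X y) e) \<le> 0"
    by (auto simp: reindex Xb y0 intro!: sum_nonpos)
  have yK': "\<bar>y i\<bar> < K" if "i < n" for i
  proof (rule ccontr)
    assume "\<not> \<bar>y i\<bar> < K"
    then have "\<bar>y i\<bar> = K" using yK[of i] by simp
    moreover have bin: "b i \<in> ?E" "b n \<in> ?E" using b_in that by auto
    moreover have Xi: "X y (b i) = y i" "X y (b n) = 0" using Xb[of i] Xb[of n] y0 that by auto
    \<comment> \<open>Coercivity is used in both directions against the pinned edge, which bounds
      \<open>\<epsilon>\<close> times the absolute value of \<open>y i\<close> by \<open>C\<close>.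
      The choice of \<open>K\<close> makes \<open>\<epsilon> * K\<close> exceed
      \<open>C\<close>.\<close>
    have "\<epsilon> * (y i - 0) - C \<le> 0" "\<epsilon> * (0 - y i) - C \<le> 0"
      using coercive[OF bin, of "X y"] coercive[OF bin(2,1), of "X y"] le0 unfolding Xi by linarith+
    ultimately have "\<epsilon> * K \<le> C" by (cases "0 \<le> y i") auto
    then show False using \<open>0 < \<epsilon>\<close> by (simp add: K_def)
  qed
  have "G (X y) (b i) = 0" if "i < n" for i
    using lo[OF that] hi[OF that] yK'[OF that] by (simp add: abs_less_iff)
  moreover from this have "G (X y) (b n) = 0"
    using sumG[of "X y"] by (simp add: reindex)
  ultimately have "G (X y) (b i) = 0" if "i < Suc n" for i
    using that less_SucE by metis
  moreover have "\<exists>i<Suc n. e = b i" if "e \<in> ?E" for e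
    using bij_betw_imp_surj_on[OF b] that by blast
  ultimately have "G (X y) e = 0" if "e \<in> ?E" for e
    using that by metis
  then have "(\<Sum>s\<in>e. ang (X y) s) = \<Delta> e" if "e \<in> ?E" for e
    using that unfolding G_def by simp
  then show thesis using that[of "X y"] unfolding ang_def by blast
qed

section \<open>Equivalence of realizability and the face conditions\<close>

theorem theorem3p1:
  fixes F :: "'f set" and gl :: "'f side \<Rightarrow> 'f side option"
    and \<Delta> :: "'f side set \<Rightarrow> real" and h :: "'f side \<Rightarrow> real"
  assumes "triangulation F gl"
    and "\<forall>e\<in>edges F gl. 0 < \<Delta> e \<and> \<Delta> e \<le> pi"
    and "dual_cocycle F gl h"
  shows "realizable F gl \<Delta> h \<longleftrightarrow>
    ((\<forall>e\<in>edges F gl. \<Delta> e > 0) \<and>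
     (\<forall>\<FF>\<subseteq>F. (\<Sum>e\<in>edges_of_faces gl \<FF>. \<Delta> e) \<ge> pi * real (card \<FF>) \<and>
        ((\<Sum>e\<in>edges_of_faces gl \<FF>. \<Delta> e) = pi * real (card \<FF>) \<longleftrightarrow>
           \<FF> = F \<or> edges_of_faces gl \<FF> = {})))"
proof
  note T = assms(1)
  assume "realizable F gl \<Delta> h"
  then obtain l where tri: "\<And>f. f \<in> F \<Longrightarrow> euclidean_triangle l f"
    and dih: "\<And>e. e \<in> edges F gl \<Longrightarrow> dihedral l e = \<Delta> e"
    unfolding realizable_def by blast
  have pos: "0 < ext_angle l s" and opp: "opp_angle l s = ext_angle l s" if s: "s \<in> sides F" for s
  proof -
    have "fst s \<in> F" "s \<in> sides {fst s}" using s by (auto simp: sides_def)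
    then show "0 < ext_angle l s" "opp_angle l s = ext_angle l s"
      using opp_angle_euclidean[OF tri] by blast+
  qed
  have face: "ext_angle l (f, 0) + ext_angle l (f, 1) + ext_angle l (f, 2) = pi" if "f \<in> F" for f
    using tri[OF that] unfolding euclidean_triangle_iff by (intro sum_ext_angle) blast+
  have sum_\<Delta>: "(\<Sum>e\<in>edges_of_faces gl \<FF>. \<Delta> e) =
      (\<Sum>e\<in>edges_of_faces gl \<FF>. \<Sum>s\<in>e. ext_angle l s)" if "\<FF> \<subseteq> F" for \<FF>
  proof (rule sum.cong)
    fix e assume "e \<in> edges_of_faces gl \<FF>"
    then have e: "e \<in> edges F gl" using edges_of_faces_mono[OF that, of gl] by (auto simp: edges_eq)
    have "(\<Sum>s\<in>e. opp_angle l s) = (\<Sum>s\<in>e. ext_angle l s)"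
      using edgeE(2)[OF T e] opp by (intro sum.cong) auto
    then show "\<Delta> e = (\<Sum>s\<in>e. ext_angle l s)" using dih[OF e] by (simp add: dihedral_def)
  qed simp
  show "(\<forall>e\<in>edges F gl. \<Delta> e > 0) \<and>
     (\<forall>\<FF>\<subseteq>F. (\<Sum>e\<in>edges_of_faces gl \<FF>. \<Delta> e) \<ge> pi * real (card \<FF>) \<and>
        ((\<Sum>e\<in>edges_of_faces gl \<FF>. \<Delta> e) = pi * real (card \<FF>) \<longleftrightarrow>
           \<FF> = F \<or> edges_of_faces gl \<FF> = {}))"
  proof (intro conjI allI impI)
    show "\<forall>e\<in>edges F gl. \<Delta> e > 0" using assms(2) by blast
    fix \<FF> assume sub: "\<FF> \<subseteq> F"
    note A = angle_sum_over_faces[OF T pos face sub]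
    show "pi * real (card \<FF>) \<le> (\<Sum>e\<in>edges_of_faces gl \<FF>. \<Delta> e)"
      unfolding sum_\<Delta>[OF sub] by (rule A(1))
    show "(\<Sum>e\<in>edges_of_faces gl \<FF>. \<Delta> e) = pi * real (card \<FF>) \<longleftrightarrow>
        \<FF> = F \<or> edges_of_faces gl \<FF> = {}"
      unfolding sum_\<Delta>[OF sub] by (rule A(2))
  qed
next
  note T = assms(1)
  assume R: "(\<forall>e\<in>edges F gl. \<Delta> e > 0) \<and>
     (\<forall>\<FF>\<subseteq>F. (\<Sum>e\<in>edges_of_faces gl \<FF>. \<Delta> e) \<ge> pi * real (card \<FF>) \<and>
        ((\<Sum>e\<in>edges_of_faces gl \<FF>. \<Delta> e) = pi * real (card \<FF>) \<longleftrightarrow>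
           \<FF> = F \<or> edges_of_faces gl \<FF> = {}))"
  have gap: "(\<Sum>e\<in>U. \<Delta> e) < pi * real (card {f\<in>F. edges_of_faces gl {f} \<inter> U \<noteq> {}})"
    if "U \<subseteq> edges F gl" "U \<noteq> {}" "U \<noteq> edges F gl" for U
    using R by (intro gap_of_face_condition[OF T _ _ _ that]) blast+
  have total: "(\<Sum>e\<in>edges F gl. \<Delta> e) = pi * real (card F)"
    using R unfolding edges_eq by blast
  obtain x where x: "\<And>e. e \<in> edges F gl \<Longrightarrow>
      (\<Sum>s\<in>e. ext_angle (\<lambda>s. exp (x (edge_of gl s) - h s / 2)) s) = \<Delta> e"
    using realize_dihedral_angles[OF T gap total, of "\<lambda>s. h s / 2"] by blast
  define l where "l s = exp (x (edge_of gl s) - h s / 2)" for s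
  have l_pos: "0 < l s" for s by (simp add: l_def)
  have sum_ext: "(\<Sum>s\<in>e. ext_angle l s) = \<Delta> e" if "e \<in> edges F gl" for e
    using x[OF that] by (simp add: l_def[abs_def])
  have pos: "0 < ext_angle l s" if "s \<in> sides F" for s
  proof (rule no_degenerate_face[OF T, where c = pi and \<Delta> = \<Delta>])
    show "0 \<le> ext_angle l s" for s by (simp add: ext_angle_def tri_angle_bounds)
    show "ext_angle l (f, 0) + ext_angle l (f, 1) + ext_angle l (f, 2) = pi" for f
      by (intro sum_ext_angle l_pos)
    show "(\<Sum>s\<in>e. ext_angle l s) = \<Delta> e \<and> \<Delta> e \<le> pi" if "e \<in> edges F gl" for e
      using sum_ext assms(2) that by blast
    show "\<exists>j. (f, j) \<in> sides F \<and> ext_angle l (f, j) = pi"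
      if s: "(f, i) \<in> sides F" and zero: "ext_angle l (f, i) = 0" for f i
    proof -
      have "(f, i) \<in> sides {f}" "f \<in> F" using s by (auto simp: sides_def)
      then have "\<not> euclidean_triangle l f" using opp_angle_euclidean(2)[of l f "(f, i)"] zero by auto
      from ext_angle_degenerate[OF l_pos l_pos l_pos this] show ?thesis
        using \<open>f \<in> F\<close> by (auto simp: sides_def)
    qed
  qed (use gap that in auto)
  \<comment> \<open>A degenerate face has one angle \<pi>, which leaves 0 for the other two, against
    \<open>pos\<close>.\<close>
  have tri: "euclidean_triangle l f" if "f \<in> F" for f
  proof (rule ccontr)
    assume "\<not> euclidean_triangle l f"
    from ext_angle_degenerate[OF l_pos l_pos l_pos this]
    obtain j where "j \<in> {0, 1, 2}" "ext_angle l (f, j) = pi" ..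
    moreover have "ext_angle l (f, 0) + ext_angle l (f, 1) + ext_angle l (f, 2) = pi"
      by (intro sum_ext_angle l_pos)
    moreover have "0 < ext_angle l (f, 0)" "0 < ext_angle l (f, 1)" "0 < ext_angle l (f, 2)"
      using that by (auto intro!: pos simp: sides_def)
    ultimately show False by auto
  qed
  have dih: "dihedral l e = \<Delta> e" if e: "e \<in> edges F gl" for e
  proof -
    have "opp_angle l s = ext_angle l s" if "s \<in> e" for s
    proof -
      have "s \<in> sides F" using edgeE(2)[OF T e that] .
      then have "fst s \<in> F" "s \<in> sides {fst s}" by (auto simp: sides_def)
      then show ?thesis using opp_angle_euclidean(1)[OF tri] by blast
    qed
    then show ?thesis using sum_ext[OF e] by (simp add: dihedral_def)
  qed
  have ratio: "log_ratio gl l s = h s" if s: "s \<in> sides F" "gl s \<noteq> None" for s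
  proof -
    obtain t where t: "gl s = Some t" using s(2) by blast
    \<comment> \<open>By antisymmetry the two halves \<open>h s / 2\<close> add up in the length
      ratio, while the common edge value of \<open>x\<close> cancels.\<close>
    have "h t = - h s" using assms(3) s t unfolding dual_cocycle_def by force
    moreover have "edge_of gl t = edge_of gl s"
      using t by (intro edge_of_eq[OF T]) (simp add: edge_of_def)
    ultimately show ?thesis by (simp add: log_ratio_def t l_def flip: exp_diff)
  qed
  have "dil_holonomy gl l ws = rep_value h ws" if "dual_loop F gl ws" for ws
  proof -
    have "log_ratio gl l s = h s" if "s \<in> set ws" for s
      using \<open>dual_loop F gl ws\<close> that by (auto simp: dual_loop_def in_set_conv_nth intro!: ratio)
    then show ?thesis unfolding dil_holonomy_def rep_value_def by (metis map_cong)
  qed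
  \<comment> \<open>The Delaunay condition is just the bound \<open>\<Delta> e \<le> pi\<close> once
    the dihedral angles are \<open>\<Delta>\<close>.\<close>
  then show "realizable F gl \<Delta> h"
    unfolding realizable_def delaunay_def using tri dih assms(2) by (intro exI[of _ l]) auto
qed

end
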